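(* Let $k\ge 1$ be an integer and let $u_k=\sum_{\mu} g_k(\mu) f^{\mu}$, where the sum is over all integer partitions $\mu$. Then $u_k$ is the number of partly ordered set partitions of $[k]$.
   Context: $[k]=\{1,2,\dots,k\}$. Integer partitions are identified with their Young diagrams and ordered by containment; $|\mu|$ is the size of $\mu$; $\emptyset$ is the only partition of $0$. $f^{\mu}$ is the number of standard Young tableaux of shape $\mu$, with $f^{\emptyset}=1$. A simplified vacillating tableau of shape $\mu$ and length $2k$ is a sequence of integer partitions $(\mu^{(0)}=\emptyset,\mu^{(1/2)},\mu^{(1)},\mu^{(3/2)},\dots,\mu^{(k-1/2)},\mu^{(k)}=\mu)$ such that for each integer $j=0,\dots,k-1$: (a) $\mu^{(j)}\supseteq\mu^{(j+1/2)}$ and $|\mu^{(j)}/\mu^{(j+1/2)}|\in\{0,1\}$; (b) $\mu^{(j+1/2)}\subseteq\mu^{(j+1)}$ and $|\mu^{(j+1)}/\mu^{(j+1/2)}|\in\{0,1\}$. $g_k(\mu)$ is the number of simplified vacillating tableaux of shape $\mu$ and length $2k$ (it is zero when $|\mu|>k$). A partly ordered set partition of a set $S$ is a set partition of $S$ together with a (possibly empty) subset of its blocks, called marked blocks, and a linear order on the marked blocks; the unmarked blocks are unordered. *)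

theory Defs
  imports "HOL-Analysis.Analysis"
begin

definition integer_partition :: "nat list \<Rightarrow> bool" where
  "integer_partition p \<longleftrightarrow> sorted_wrt (\<ge>) p \<and> 0 \<notin> set p"

text \<open>
  Integer partitions are represented by their Young diagrams: containment is then \<open>\<subseteq>\<close>,
  the skew diagram \<open>\<mu>/\<nu>\<close> is \<open>\<mu> - \<nu>\<close>, and sizes are given by \<open>card\<close>.
  Cells are pairs (row, column), both counted from 0.
\<close>

type_synonym diagram = "(nat \<times> nat) set"

definition young_diagram :: "nat list \<Rightarrow> diagram" where
  "young_diagram p = {(i, j). i < length p \<and> j < p ! i}"

definition partitions :: "diagram set" where
  "partitions = young_diagram ` {p. integer_partition p}"

text \<open>
  A tableau is a function on cells; \<open>\<rightarrow>\<^sub>E\<close> fixes its values outside the diagram, so that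
  each filling is counted once.
\<close>

definition standard_young_tableaux :: "diagram \<Rightarrow> (nat \<times> nat \<Rightarrow> nat) set" where
  "standard_young_tableaux \<mu> = {T \<in> \<mu> \<rightarrow>\<^sub>E {1..card \<mu>}.
     bij_betw T \<mu> {1..card \<mu>} \<and>
     (\<forall>i j j'. (i, j) \<in> \<mu> \<longrightarrow> (i, j') \<in> \<mu> \<longrightarrow> j < j' \<longrightarrow> T (i, j) < T (i, j')) \<and>
     (\<forall>i i' j. (i, j) \<in> \<mu> \<longrightarrow> (i', j) \<in> \<mu> \<longrightarrow> i < i' \<longrightarrow> T (i, j) < T (i', j))}"

definition num_syt :: "diagram \<Rightarrow> nat" where
  "num_syt \<mu> = card (standard_young_tableaux \<mu>)"

text \<open>
  Indices are doubled: for \<open>m \<le> 2 * k\<close>, the entry \<open>\<nu> ! m\<close> is the partition with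
  (half-integer) index \<open>m/2\<close>.
\<close>

definition vacillating_tableaux :: "nat \<Rightarrow> diagram \<Rightarrow> diagram list set" where
  "vacillating_tableaux k \<mu> = {\<nu>. length \<nu> = 2 * k + 1 \<and> set \<nu> \<subseteq> partitions \<and>
     \<nu> ! 0 = {} \<and> \<nu> ! (2 * k) = \<mu> \<and>
     (\<forall>j<k.
        \<nu> ! (2 * j + 1) \<subseteq> \<nu> ! (2 * j) \<and>
        card (\<nu> ! (2 * j) - \<nu> ! (2 * j + 1)) \<in> {0, 1} \<and>
        \<nu> ! (2 * j + 1) \<subseteq> \<nu> ! (2 * j + 2) \<and>
        card (\<nu> ! (2 * j + 2) - \<nu> ! (2 * j + 1)) \<in> {0, 1})}"

definition num_vacillating :: "nat \<Rightarrow> diagram \<Rightarrow> nat" where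
  "num_vacillating k \<mu> = card (vacillating_tableaux k \<mu>)"

text \<open>
  Only finitely many terms of the sum are nonzero, since \<open>num_vacillating k \<mu> = 0\<close>
  for \<open>card \<mu> > k\<close>.
\<close>

definition u :: "nat \<Rightarrow> nat" where
  "u k = (\<Sum>\<^sub>\<infinity>\<mu>\<in>partitions. num_vacillating k \<mu> * num_syt \<mu>)"

text \<open>
  In a triple \<open>(P, M, r)\<close>, \<open>M\<close> is the set of marked blocks of \<open>P\<close> and \<open>r\<close> the reflexive
  linear order on them.
\<close>

definition partly_ordered_set_partitions ::
  "'a set \<Rightarrow> ('a set set \<times> 'a set set \<times> 'a set rel) set" where
  "partly_ordered_set_partitions S =
     {(P, M, r). partition_on S P \<and> M \<subseteq> P \<and> linear_order_on M r}"

end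

theory Submission
  imports Defs
begin

text \<open>
  Both sides are sums of two-parameter arrays with the same initial values and recurrence.

  Let \<open>w k n\<close> be the part of \<open>u k\<close> contributed by the shapes of size \<open>n\<close>, that is, the sum of
  \<open>g\<^sub>k(\<mu>) f\<^sup>\<mu>\<close> over all \<open>\<mu>\<close> with \<open>|\<mu>| = n\<close>.  Weighting shapes by \<open>f\<^sup>\<mu>\<close> makes the position of the
  added or removed cell irrelevant: for nonempty \<open>\<mu>\<close>, the weights of the shapes obtained by
  removing a cell from \<open>\<mu>\<close> add up to \<open>f\<^sup>\<mu>\<close> (\<open>num_syt_down\<close>, delete the largest entry), and the
  weights of the shapes obtained by adding a cell to a shape \<open>\<nu>\<close> of size \<open>n\<close> add up to
  \<open>(n + 1) f\<^sup>\<nu>\<close> (\<open>num_syt_up\<close>).  The second fact follows from the first because Young's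
  lattice is differential: every shape has one more addable than removable cell (\<open>card_up\<close>), and
  two distinct shapes of the same size have a common cover, their union, exactly when they have a
  common lower neighbour, their intersection (\<open>sum_up_down_commute\<close>).  Hence the two half steps of a
  vacillating tableau give
  \<open>w (k + 1) n = w k (n + 1) + (n + 1) * w k n + n * w k (n - 1)\<close> (\<open>tableau_weight_Suc\<close>).

  Let \<open>c k n\<close> be the number of partly ordered set partitions of \<open>{1..k}\<close> with \<open>n\<close> marked blocks;
  a set partition with \<open>p\<close> blocks underlies \<open>n! * (p choose n)\<close> of them.  The array \<open>c\<close> satisfies
  the same recurrence (\<open>num_marked_partitions_Suc\<close>).  Combinatorially, consider the block \<open>B\<close> of
  \<open>k + 1\<close>, and delete \<open>k + 1\<close> from it.  If \<open>B\<close> is unmarked, then either nothing remains of it,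
  leaving \<open>n\<close> marked blocks, or what remains can be recorded by marking it as the new first block,
  leaving \<open>n + 1\<close>.  If \<open>B\<close> is marked, then its place in the order is one of \<open>n\<close>; if something remains
  of it, there are still \<open>n\<close> marked blocks, and otherwise \<open>n - 1\<close>.  The formal proof verifies this
  through the recursion for sums over set partitions (\<open>sum_partition_on_insert\<close>) and an identity
  between binomial coefficients.
\<close>

section \<open>Young's lattice\<close>

text \<open>
  Order ideals are closed under union and intersection and are easy to change by one cell,
  so most arguments below use this description of diagrams.  Conversely, the row lengths of a finite
  ideal form its partition.
\<close>
lemma partitions_iff_order_ideal:
  "\<mu> \<in> partitions \<longleftrightarrow>
     finite \<mu> \<and> (\<forall>i j i' j'. (i, j) \<in> \<mu> \<longrightarrow> i' \<le> i \<longrightarrow> j' \<le> j \<longrightarrow> (i', j') \<in> \<mu>)"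
  (is "_ \<longleftrightarrow> ?ideal \<mu>")
proof
  assume "\<mu> \<in> partitions"
  then obtain p where p: "sorted_wrt (\<ge>) p" and \<mu>: "\<mu> = young_diagram p"
    by (auto simp: partitions_def integer_partition_def)
  have "\<mu> \<subseteq> (\<Union>i<length p. {i} \<times> {..<p ! i})"
    by (auto simp: \<mu> young_diagram_def)
  then have "finite \<mu>"
    by (rule finite_subset) auto
  moreover have "(i', j') \<in> \<mu>" if "(i, j) \<in> \<mu>" "i' \<le> i" "j' \<le> j" for i j i' j'
  proof -
    have "p ! i' \<ge> p ! i"
      using that p by (cases "i' = i") (auto simp: \<mu> young_diagram_def sorted_wrt_iff_nth_less)
    then show ?thesis
      using that by (auto simp: \<mu> young_diagram_def)
  qed
  ultimately show "?ideal \<mu>"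
    by blast
next
  assume ideal: "?ideal \<mu>"
  define r where "r = (\<lambda>i. card {j. (i, j) \<in> \<mu>})"
  define n where "n = card {i. (i, 0) \<in> \<mu>}"
  have fin: "finite {j. (i, j) \<in> \<mu>}" for i
    by (rule finite_subset[of _ "snd ` \<mu>"]) (use ideal in force)+
  have fin0: "finite {i. (i, 0) \<in> \<mu>}"
    by (rule finite_subset[of _ "fst ` \<mu>"]) (use ideal in force)+
  \<comment> \<open>A finite initial segment of the naturals is determined by its cardinality.\<close>
  have lower: "x \<in> X \<longleftrightarrow> x < card X"
    if "finite X" "\<And>y z. y \<in> X \<Longrightarrow> z \<le> y \<Longrightarrow> z \<in> X" for x and X :: "nat set"
  proof
    assume "x \<in> X"
    then have "{..x} \<subseteq> X"
      using that by auto
    then show "x < card X"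
      using card_mono[OF \<open>finite X\<close>, of "{..x}"] by simp
  next
    assume "x < card X"
    show "x \<in> X"
    proof (rule ccontr)
      assume "x \<notin> X"
      then have "X \<subseteq> {..<x}"
        using that(2) by (auto simp: not_le[symmetric])
      then show False
        using \<open>x < card X\<close> card_mono[of "{..<x}" X] by auto
    qed
  qed
  have mem: "(i, j) \<in> \<mu> \<longleftrightarrow> j < r i" for i j
    using lower[OF fin, of i j] ideal unfolding r_def by blast
  have rows: "0 < r i \<longleftrightarrow> i < n" for i
    using lower[OF fin0, of i] ideal mem[of i 0] unfolding n_def by blast
  have anti: "r i' \<ge> r i" if "i' \<le> i" for i i'
    using that ideal mem[of i "r i'"] mem[of i' "r i'"] by (metis leI less_irrefl order_refl)
  have "r i \<noteq> 0" if "i < n" for i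
    using that rows[of i] by simp
  then have "integer_partition (map r [0..<n])"
    using anti by (simp add: integer_partition_def sorted_wrt_iff_nth_less image_iff)
  moreover have "i < n" if "j < r i" for i j
    using that rows[of i] by linarith
  then have "\<mu> = young_diagram (map r [0..<n])"
    by (auto simp: young_diagram_def mem)
  ultimately show "\<mu> \<in> partitions"
    by (auto simp: partitions_def)
qed

lemma partitionI:
  assumes "finite \<mu>"
    and "\<And>i j i' j'. (i, j) \<in> \<mu> \<Longrightarrow> i' \<le> i \<Longrightarrow> j' \<le> j \<Longrightarrow> (i', j') \<in> \<mu>"
  shows "\<mu> \<in> partitions"
  using assms unfolding partitions_iff_order_ideal by blast

lemma finite_partition: "\<mu> \<in> partitions \<Longrightarrow> finite \<mu>"
  by (simp add: partitions_iff_order_ideal)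

lemma partitionD: "\<mu> \<in> partitions \<Longrightarrow> (i, j) \<in> \<mu> \<Longrightarrow> i' \<le> i \<Longrightarrow> j' \<le> j \<Longrightarrow> (i', j') \<in> \<mu>"
  by (simp add: partitions_iff_order_ideal)

lemma empty_partition: "{} \<in> partitions"
  by (simp add: partitions_iff_order_ideal)

lemma partition_Un: "\<mu> \<in> partitions \<Longrightarrow> \<nu> \<in> partitions \<Longrightarrow> \<mu> \<union> \<nu> \<in> partitions"
  by (auto simp: partitions_iff_order_ideal)

lemma partition_Int: "\<mu> \<in> partitions \<Longrightarrow> \<nu> \<in> partitions \<Longrightarrow> \<mu> \<inter> \<nu> \<in> partitions"
  by (auto simp: partitions_iff_order_ideal)

definition partitions_of_size :: "nat \<Rightarrow> diagram set" where
  "partitions_of_size n = {\<mu> \<in> partitions. card \<mu> = n}"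

lemma partition_subset_square:
  assumes "\<mu> \<in> partitions"
  shows "\<mu> \<subseteq> {..<card \<mu>} \<times> {..<card \<mu>}"
proof (rule subrelI)
  fix i j assume ij: "(i, j) \<in> \<mu>"
  have "(\<lambda>i'. (i', j)) ` {..i} \<subseteq> \<mu>" "(\<lambda>j'. (i, j')) ` {..j} \<subseteq> \<mu>"
    using partitionD[OF assms ij] by auto
  then have "card ((\<lambda>i'. (i', j)) ` {..i}) \<le> card \<mu>" "card ((\<lambda>j'. (i, j')) ` {..j}) \<le> card \<mu>"
    by (auto intro!: card_mono finite_partition assms)
  then show "(i, j) \<in> {..<card \<mu>} \<times> {..<card \<mu>}"
    by (auto simp: card_image inj_on_def)
qed

lemma finite_partitions_of_size: "finite (partitions_of_size n)"
  by (rule finite_subset[of _ "Pow ({..<n} \<times> {..<n})"])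
    (use partition_subset_square in \<open>auto simp: partitions_of_size_def\<close>)

definition up :: "diagram \<Rightarrow> diagram set" where
  "up \<nu> = {\<mu> \<in> partitions. \<nu> \<subseteq> \<mu> \<and> card (\<mu> - \<nu>) = 1}"

definition down :: "diagram \<Rightarrow> diagram set" where
  "down \<mu> = {\<nu> \<in> partitions. \<nu> \<subseteq> \<mu> \<and> card (\<mu> - \<nu>) = 1}"

lemma in_up_iff: "\<mu> \<in> up \<nu> \<longleftrightarrow> \<mu> \<in> partitions \<and> (\<exists>c. c \<notin> \<nu> \<and> \<mu> = insert c \<nu>)"
  by (auto simp: up_def card_1_singleton_iff)

lemma in_down_iff: "\<nu> \<in> down \<mu> \<longleftrightarrow> \<nu> \<in> partitions \<and> (\<exists>c\<in>\<mu>. \<nu> = \<mu> - {c})"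
  by (auto simp: down_def card_1_singleton_iff)

lemma up_down_iff:
  "\<mu> \<in> partitions \<and> \<nu> \<in> down \<mu> \<longleftrightarrow> \<nu> \<in> partitions \<and> \<mu> \<in> up \<nu>"
  by (auto simp: up_def down_def)

lemma card_up_elem: "\<nu> \<in> partitions \<Longrightarrow> \<mu> \<in> up \<nu> \<Longrightarrow> card \<mu> = Suc (card \<nu>)"
  by (auto simp: in_up_iff finite_partition)

lemma card_down_elem: "\<mu> \<in> partitions \<Longrightarrow> \<nu> \<in> down \<mu> \<Longrightarrow> card \<mu> = Suc (card \<nu>)"
  using up_down_iff card_up_elem by blast

lemma finite_up: "\<nu> \<in> partitions \<Longrightarrow> finite (up \<nu>)"
  by (rule finite_subset[OF _ finite_partitions_of_size[of "Suc (card \<nu>)"]])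
    (auto simp: partitions_of_size_def card_up_elem, auto simp: up_def)

lemma finite_down: "\<mu> \<in> partitions \<Longrightarrow> finite (down \<mu>)"
  by (rule finite_subset[of _ "Pow \<mu>"]) (auto simp: down_def finite_partition)

text \<open>
  A cell can be added at the end of row \<open>i\<close> iff \<open>i = 0\<close> or row \<open>i\<close> is shorter than row \<open>i - 1\<close>; a
  cell can be removed from row \<open>i\<close> iff row \<open>i + 1\<close> is shorter than row \<open>i\<close>.  So shifting by one row
  matches the removable cells with all addable ones but that of row 0.
\<close>
lemma card_up:
  assumes \<nu>: "\<nu> \<in> partitions"
  shows "card (up \<nu>) = Suc (card (down \<nu>))"
proof -
  obtain p where p: "sorted_wrt (\<ge>) p" "0 \<notin> set p" and \<nu>_eq: "\<nu> = young_diagram p"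
    using \<nu> by (auto simp: partitions_def integer_partition_def)
  define r where "r = (\<lambda>i. if i < length p then p ! i else 0)"
  have mem: "(i, j) \<in> \<nu> \<longleftrightarrow> j < r i" for i j
    by (auto simp: \<nu>_eq young_diagram_def r_def)
  have anti: "r i' \<ge> r i" if "i' \<le> i" for i i'
    using partitionD[OF \<nu>, of i "r i'" i' "r i'"] that by (metis leI less_irrefl mem order_refl)
  define R where "R = {i. r (Suc i) < r i}"
  have "R \<subseteq> {..<length p}"
    by (auto simp: R_def r_def split: if_splits)
  then have "finite R"
    by (rule finite_subset) auto
  have up: "up \<nu> = (\<lambda>i. insert (i, r i) \<nu>) ` insert 0 (Suc ` R)"
  proof (intro set_eqI iffI)
    fix \<mu> assume "\<mu> \<in> up \<nu>"
    then obtain i j where ij: "(i, j) \<notin> \<nu>" "\<mu> = insert (i, j) \<nu>" "\<mu> \<in> partitions"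
      by (auto simp: in_up_iff)
    have "(i, r i) \<in> \<mu>"
      by (rule partitionD[OF ij(3), of i j]) (use ij in \<open>auto simp: mem\<close>)
    then have j: "j = r i"
      by (auto simp: ij mem)
    have "i = 0 \<or> i \<in> Suc ` R"
    proof (cases i)
      case (Suc i')
      have "(i', r i) \<in> \<mu>"
        by (rule partitionD[OF ij(3), of i j]) (use ij j Suc in auto)
      then show ?thesis
        using Suc by (auto simp: ij R_def mem)
    qed simp
    then show "\<mu> \<in> (\<lambda>i. insert (i, r i) \<nu>) ` insert 0 (Suc ` R)"
      using ij(2) j by blast
  next
    fix \<mu> assume "\<mu> \<in> (\<lambda>i. insert (i, r i) \<nu>) ` insert 0 (Suc ` R)"
    then obtain i where i: "i = 0 \<or> i \<in> Suc ` R" and \<mu>: "\<mu> = insert (i, r i) \<nu>"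
      by blast
    have prev: "(i', r i) \<in> \<nu>" if "i' < i" for i'
      using i that anti[of i' "i - 1"] by (auto simp: mem R_def)
    have "(a', b') \<in> \<mu>" if "(a, b) \<in> \<mu>" "a' \<le> a" "b' \<le> b" for a b a' b'
    proof (cases "(a, b) \<in> \<nu>")
      case True
      then show ?thesis
        using partitionD[OF \<nu>] that \<mu> by blast
    next
      case False
      then have ab: "a = i" "b = r i"
        using that \<mu> by auto
      show ?thesis
      proof (cases "a' = i")
        case True
        then show ?thesis
          using that ab by (auto simp: \<mu> mem)
      next
        case False
        then have "(a', r i) \<in> \<nu>"
          using prev that ab by simp
        then show ?thesis
          using partitionD[OF \<nu>] that ab \<mu> by blast
      qed
    qed
    then have "\<mu> \<in> partitions"
      by (rule partitionI[rotated]) (simp_all add: \<mu> finite_partition \<nu>)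
    then show "\<mu> \<in> up \<nu>"
      by (auto simp: in_up_iff \<mu> mem)
  qed
  have down: "down \<nu> = (\<lambda>i. \<nu> - {(i, r i - 1)}) ` R"
  proof (intro set_eqI iffI)
    fix \<mu> assume "\<mu> \<in> down \<nu>"
    then obtain i j where ij: "(i, j) \<in> \<nu>" "\<mu> = \<nu> - {(i, j)}" "\<mu> \<in> partitions"
      by (auto simp: in_down_iff)
    have "(i, Suc j) \<notin> \<mu>" "(Suc i, j) \<notin> \<mu>"
      using partitionD[OF ij(3), of i "Suc j" i j] partitionD[OF ij(3), of "Suc i" j i j] ij
      by auto
    then have "r i = Suc j" "i \<in> R"
      using ij by (auto simp: mem R_def)
    then show "\<mu> \<in> (\<lambda>i. \<nu> - {(i, r i - 1)}) ` R"
      using ij(2) by auto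
  next
    fix \<mu> assume "\<mu> \<in> (\<lambda>i. \<nu> - {(i, r i - 1)}) ` R"
    then obtain i where i: "r (Suc i) < r i" and \<mu>: "\<mu> = \<nu> - {(i, r i - 1)}"
      by (auto simp: R_def)
    have "(a', b') \<in> \<mu>" if "(a, b) \<in> \<mu>" "a' \<le> a" "b' \<le> b" for a b a' b'
    proof -
      have "(a', b') \<in> \<nu>"
        using partitionD[OF \<nu>] that \<mu> by blast
      moreover have "(a', b') \<noteq> (i, r i - 1)"
      proof
        assume eq: "(a', b') = (i, r i - 1)"
        have "a = i"
          using that eq i anti[of "Suc i" a] by (cases "a = i") (auto simp: \<mu> mem)
        then show False
          using that eq by (auto simp: \<mu> mem)
      qed
      ultimately show ?thesis
        by (simp add: \<mu>)
    qed
    then have "\<mu> \<in> partitions"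
      by (rule partitionI[rotated]) (simp_all add: \<mu> finite_partition \<nu>)
    moreover have "(i, r i - 1) \<in> \<nu>"
      using i by (auto simp: mem)
    ultimately show "\<mu> \<in> down \<nu>"
      by (auto simp: in_down_iff \<mu>)
  qed
  have "card (up \<nu>) = card (insert 0 (Suc ` R))"
    unfolding up
  proof (rule card_image, rule inj_onI)
    fix i i' assume eq: "insert (i, r i) \<nu> = insert (i', r i') \<nu>"
    have "(i, r i) \<notin> \<nu>"
      by (simp add: mem)
    then show "i = i'"
      using eq by blast
  qed
  also have "\<dots> = Suc (card R)"
    using \<open>finite R\<close> by (subst card_insert_disjoint) (auto simp: card_image)
  also have "card R = card (down \<nu>)"
    unfolding down
  proof (rule card_image[symmetric], rule inj_onI)
    fix i i' assume "i \<in> R" "i' \<in> R" and eq: "\<nu> - {(i, r i - 1)} = \<nu> - {(i', r i' - 1)}"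
    then have "(i, r i - 1) \<in> \<nu>"
      by (auto simp: R_def mem)
    then show "i = i'"
      using eq by blast
  qed
  finally show ?thesis .
qed

text \<open>
  This is the relation \<open>D U = U D + I\<close> between the operators that add and remove a cell, applied to
  an arbitrary function.  The terms with \<open>\<nu>' \<noteq> \<nu>\<close> correspond to each other: there the
  intermediate shapes can only be \<open>\<nu> \<union> \<nu>'\<close> and \<open>\<nu> \<inter> \<nu>'\<close>.  The terms with \<open>\<nu>' = \<nu>\<close> are counted by
  the degrees of \<open>\<nu>\<close>, which differ by one.
\<close>
lemma sum_up_down_commute:
  fixes \<phi> :: "diagram \<Rightarrow> nat"
  assumes \<nu>: "\<nu> \<in> partitions"
  shows "(\<Sum>\<mu>\<in>up \<nu>. \<Sum>\<nu>'\<in>down \<mu>. \<phi> \<nu>') = \<phi> \<nu> + (\<Sum>\<kappa>\<in>down \<nu>. \<Sum>\<nu>'\<in>up \<kappa>. \<phi> \<nu>')"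
proof -
  have up: "\<mu> \<in> partitions" "\<nu> \<in> down \<mu>" if "\<mu> \<in> up \<nu>" for \<mu>
    using that \<nu> up_down_iff[of \<mu> \<nu>] by auto
  have down: "\<kappa> \<in> partitions" "\<nu> \<in> up \<kappa>" if "\<kappa> \<in> down \<nu>" for \<kappa>
    using that \<nu> up_down_iff[of \<nu> \<kappa>] by auto
  have "(\<Sum>\<mu>\<in>up \<nu>. \<Sum>\<nu>'\<in>down \<mu>. \<phi> \<nu>') = (\<Sum>\<mu>\<in>up \<nu>. \<phi> \<nu> + (\<Sum>\<nu>'\<in>down \<mu> - {\<nu>}. \<phi> \<nu>'))"
    by (rule sum.cong[OF refl], rule sum.remove) (simp_all add: finite_down up)
  also have "\<dots> = card (up \<nu>) * \<phi> \<nu> + (\<Sum>\<mu>\<in>up \<nu>. \<Sum>\<nu>'\<in>down \<mu> - {\<nu>}. \<phi> \<nu>')"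
    by (simp add: sum.distrib)
  also have "(\<Sum>\<mu>\<in>up \<nu>. \<Sum>\<nu>'\<in>down \<mu> - {\<nu>}. \<phi> \<nu>') = (\<Sum>\<kappa>\<in>down \<nu>. \<Sum>\<nu>'\<in>up \<kappa> - {\<nu>}. \<phi> \<nu>')"
  proof -
    have "(\<Sum>(\<mu>, \<nu>')\<in>Sigma (up \<nu>) (\<lambda>\<mu>. down \<mu> - {\<nu>}). \<phi> \<nu>') =
        (\<Sum>(\<kappa>, \<nu>')\<in>Sigma (down \<nu>) (\<lambda>\<kappa>. up \<kappa> - {\<nu>}). \<phi> \<nu>')"
    proof (rule sum.reindex_bij_witness
        [where i = "\<lambda>(\<kappa>, \<nu>'). (\<nu> \<union> \<nu>', \<nu>')" and j = "\<lambda>(\<mu>, \<nu>'). (\<nu> \<inter> \<nu>', \<nu>')"])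
      fix x assume "x \<in> Sigma (up \<nu>) (\<lambda>\<mu>. down \<mu> - {\<nu>})"
      then obtain \<mu> \<nu>' where x: "x = (\<mu>, \<nu>')" "\<mu> \<in> up \<nu>" "\<nu>' \<in> down \<mu>" "\<nu>' \<noteq> \<nu>"
        by auto
      obtain c where c: "c \<notin> \<nu>" "\<mu> = insert c \<nu>"
        using x by (auto simp: in_up_iff)
      obtain d where d: "d \<in> \<mu>" "\<nu>' = \<mu> - {d}" and \<nu>': "\<nu>' \<in> partitions"
        using x by (auto simp: in_down_iff)
      have "d \<in> \<nu>"
        using c d x by auto
      have "\<nu> \<inter> \<nu>' = \<nu> - {d}" "\<nu>' = insert c (\<nu> \<inter> \<nu>')" "\<mu> = \<nu> \<union> \<nu>'"
        using c d \<open>d \<in> \<nu>\<close> by auto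
      moreover have "\<nu> \<inter> \<nu>' \<in> partitions"
        using \<nu> \<nu>' by (rule partition_Int)
      ultimately have "\<nu> \<inter> \<nu>' \<in> down \<nu>" "\<nu>' \<in> up (\<nu> \<inter> \<nu>')"
        using c \<open>d \<in> \<nu>\<close> \<nu>' unfolding in_down_iff in_up_iff by blast+
      then show "(case case x of (\<mu>, \<nu>') \<Rightarrow> (\<nu> \<inter> \<nu>', \<nu>') of (\<kappa>, \<nu>') \<Rightarrow> (\<nu> \<union> \<nu>', \<nu>')) = x"
        and "(case x of (\<mu>, \<nu>') \<Rightarrow> (\<nu> \<inter> \<nu>', \<nu>')) \<in> Sigma (down \<nu>) (\<lambda>\<kappa>. up \<kappa> - {\<nu>})"
        using x \<open>\<mu> = \<nu> \<union> \<nu>'\<close>[symmetric] by simp_all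
    next
      fix x assume "x \<in> Sigma (down \<nu>) (\<lambda>\<kappa>. up \<kappa> - {\<nu>})"
      then obtain \<kappa> \<nu>' where x: "x = (\<kappa>, \<nu>')" "\<kappa> \<in> down \<nu>" "\<nu>' \<in> up \<kappa>" "\<nu>' \<noteq> \<nu>"
        by auto
      obtain c where c: "c \<in> \<nu>" "\<kappa> = \<nu> - {c}"
        using x by (auto simp: in_down_iff)
      obtain d where d: "d \<notin> \<kappa>" "\<nu>' = insert d \<kappa>" and \<nu>': "\<nu>' \<in> partitions"
        using x by (auto simp: in_up_iff)
      have "d \<notin> \<nu>"
        using c d x by auto
      have "\<nu> \<union> \<nu>' = insert d \<nu>" "\<nu>' = (\<nu> \<union> \<nu>') - {c}" "\<kappa> = \<nu> \<inter> \<nu>'"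
        using c d \<open>d \<notin> \<nu>\<close> by auto
      moreover have "\<nu> \<union> \<nu>' \<in> partitions"
        using \<nu> \<nu>' by (rule partition_Un)
      ultimately have "\<nu> \<union> \<nu>' \<in> up \<nu>" "\<nu>' \<in> down (\<nu> \<union> \<nu>')"
        using c \<open>d \<notin> \<nu>\<close> \<nu>' unfolding in_down_iff in_up_iff by blast+
      then show "(case case x of (\<kappa>, \<nu>') \<Rightarrow> (\<nu> \<union> \<nu>', \<nu>') of (\<mu>, \<nu>') \<Rightarrow> (\<nu> \<inter> \<nu>', \<nu>')) = x"
        and "(case x of (\<kappa>, \<nu>') \<Rightarrow> (\<nu> \<union> \<nu>', \<nu>')) \<in> Sigma (up \<nu>) (\<lambda>\<mu>. down \<mu> - {\<nu>})"
        using x \<open>\<kappa> = \<nu> \<inter> \<nu>'\<close>[symmetric] by simp_all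
    qed auto
    then show ?thesis
      using up down \<nu> by (simp add: sum.Sigma finite_up finite_down)
  qed
  also have "card (up \<nu>) * \<phi> \<nu> + \<dots> = \<phi> \<nu> + (\<Sum>\<kappa>\<in>down \<nu>. \<phi> \<nu> + (\<Sum>\<nu>'\<in>up \<kappa> - {\<nu>}. \<phi> \<nu>'))"
    by (simp add: card_up[OF \<nu>] sum.distrib)
  also have "(\<Sum>\<kappa>\<in>down \<nu>. \<phi> \<nu> + (\<Sum>\<nu>'\<in>up \<kappa> - {\<nu>}. \<phi> \<nu>')) = (\<Sum>\<kappa>\<in>down \<nu>. \<Sum>\<nu>'\<in>up \<kappa>. \<phi> \<nu>')"
    by (rule sum.cong[OF refl], rule sum.remove[symmetric]) (simp_all add: finite_up down)
  finally show ?thesis .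
qed

section \<open>Standard Young tableaux\<close>

lemma finite_standard_young_tableaux:
  assumes "\<mu> \<in> partitions"
  shows "finite (standard_young_tableaux \<mu>)"
  by (rule finite_subset[of _ "\<mu> \<rightarrow>\<^sub>E {1..card \<mu>}"])
    (auto simp: standard_young_tableaux_def intro: finite_PiE finite_partition[OF assms])

lemma num_syt_empty: "num_syt {} = 1"
proof -
  have "standard_young_tableaux {} = {\<lambda>x. undefined}"
    by (auto simp: standard_young_tableaux_def bij_betw_def)
  then show ?thesis
    by (simp add: num_syt_def)
qed

lemma standard_young_tableauxI:
  assumes "T \<in> extensional \<mu>" "bij_betw T \<mu> {1..card \<mu>}"
    and "\<And>i j j'. (i, j) \<in> \<mu> \<Longrightarrow> (i, j') \<in> \<mu> \<Longrightarrow> j < j' \<Longrightarrow> T (i, j) < T (i, j')"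
    and "\<And>i i' j. (i, j) \<in> \<mu> \<Longrightarrow> (i', j) \<in> \<mu> \<Longrightarrow> i < i' \<Longrightarrow> T (i, j) < T (i', j)"
  shows "T \<in> standard_young_tableaux \<mu>"
  using assms unfolding standard_young_tableaux_def PiE_def bij_betw_def by blast

lemma standard_young_tableauxD:
  assumes "T \<in> standard_young_tableaux \<mu>"
  shows "T \<in> extensional \<mu>" and "bij_betw T \<mu> {1..card \<mu>}"
    and "\<And>i j j'. (i, j) \<in> \<mu> \<Longrightarrow> (i, j') \<in> \<mu> \<Longrightarrow> j < j' \<Longrightarrow> T (i, j) < T (i, j')"
    and "\<And>i i' j. (i, j) \<in> \<mu> \<Longrightarrow> (i', j) \<in> \<mu> \<Longrightarrow> i < i' \<Longrightarrow> T (i, j) < T (i', j)"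
  using assms unfolding standard_young_tableaux_def PiE_def by blast+

text \<open>
  Entries increase downwards and to the right, so no other cell lies weakly below and weakly to the
  right of the largest entry: its cell is a corner.
\<close>
lemma standard_young_tableaux_remove_max:
  assumes \<mu>: "\<mu> \<in> partitions" and T: "T \<in> standard_young_tableaux \<mu>"
    and c: "c \<in> \<mu>" "T c = card \<mu>"
  shows "\<mu> - {c} \<in> down \<mu>" and "restrict T (\<mu> - {c}) \<in> standard_young_tableaux (\<mu> - {c})"
proof -
  note T' = standard_young_tableauxD[OF T]
  have fin: "finite \<mu>"
    using \<mu> by (rule finite_partition)
  have le: "T d \<le> card \<mu>" if "d \<in> \<mu>" for d
    using T'(2) that by (auto simp: bij_betw_def)
  have "\<mu> - {c} \<in> partitions"
  proof (rule partitionI)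
    fix i j i' j' assume ij: "(i, j) \<in> \<mu> - {c}" "i' \<le> i" "j' \<le> j"
    have cells: "(i', j') \<in> \<mu>" "(i', j) \<in> \<mu>"
      using partitionD[OF \<mu>, of i j] ij by auto
    have "T (i', j') \<le> T (i', j)"
      using T'(3)[of i' j' j] cells ij by (cases "j' = j") auto
    moreover have "T (i', j) \<le> T (i, j)"
      using T'(4)[of i' j i] cells ij by (cases "i' = i") auto
    moreover have "T (i, j) \<noteq> T c"
      using T'(2) ij c by (auto simp: bij_betw_def inj_on_def)
    ultimately have "T (i', j') < card \<mu>"
      using le[of "(i, j)"] ij c by auto
    then show "(i', j') \<in> \<mu> - {c}"
      using cells c by auto
  qed (use fin in simp)
  then show "\<mu> - {c} \<in> down \<mu>"
    using c by (auto simp: in_down_iff)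
  have card: "card (\<mu> - {c}) = card \<mu> - 1"
    using fin c by simp
  have "bij_betw T (\<mu> - {c}) ({1..card \<mu>} - {card \<mu>})"
    using c fin by (intro bij_betw_DiffI T'(2)) (auto simp: bij_betw_def Suc_le_eq card_gt_0_iff)
  moreover have "{1..card \<mu>} - {card \<mu>} = {1..card (\<mu> - {c})}"
    unfolding card by auto
  ultimately have "bij_betw T (\<mu> - {c}) {1..card (\<mu> - {c})}"
    by simp
  then have "bij_betw (restrict T (\<mu> - {c})) (\<mu> - {c}) {1..card (\<mu> - {c})}"
    by (rule bij_betw_cong[THEN iffD1, rotated]) simp
  then show "restrict T (\<mu> - {c}) \<in> standard_young_tableaux (\<mu> - {c})"
    by (rule standard_young_tableauxI[rotated]) (auto intro: T'(3,4))
qed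

lemma standard_young_tableaux_add_max:
  assumes \<mu>: "\<mu> \<in> partitions" and \<nu>: "\<nu> \<in> down \<mu>" and T: "T \<in> standard_young_tableaux \<nu>"
  shows "(\<lambda>d\<in>\<mu>. if d \<in> \<nu> then T d else card \<mu>) \<in> standard_young_tableaux \<mu>"
    (is "?T \<in> _")
proof (rule standard_young_tableauxI)
  note T' = standard_young_tableauxD[OF T]
  obtain c where c: "c \<in> \<mu>" "\<nu> = \<mu> - {c}" and "\<nu> \<in> partitions"
    using \<nu> by (auto simp: in_down_iff)
  have card: "card \<mu> = Suc (card \<nu>)"
    using card_down_elem[OF \<mu> \<nu>] .
  have less: "T d < card \<mu>" if "d \<in> \<nu>" for d
    using bij_betwE[OF T'(2)] that card by (simp add: less_Suc_eq_le)
  have \<mu>_eq: "\<mu> = insert c \<nu>"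
    using c by auto
  have "bij_betw ?T \<nu> {1..card \<nu>}"
    using T'(2) by (rule bij_betw_cong[THEN iffD1, rotated]) (simp add: \<mu>_eq)
  moreover have "?T c = card \<mu>"
    using c by simp
  moreover have "c \<notin> \<nu>"
    using c by simp
  ultimately have "bij_betw ?T (insert c \<nu>) (insert (card \<mu>) {1..card \<nu>})"
    using notIn_Un_bij_betw[of c \<nu> ?T "{1..card \<nu>}"] by (simp add: card)
  moreover have "insert (card \<mu>) {1..card \<nu>} = {1..card \<mu>}"
    unfolding card by auto
  ultimately show "bij_betw ?T \<mu> {1..card \<mu>}"
    by (simp only: \<mu>_eq[symmetric])
  show "?T (i, j) < ?T (i, j')" if "(i, j) \<in> \<mu>" "(i, j') \<in> \<mu>" "j < j'" for i j j'
  proof (cases "(i, j') \<in> \<nu>")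
    case True
    then have "(i, j) \<in> \<nu>"
      using partitionD[OF \<open>\<nu> \<in> partitions\<close>, of i j' i j] that by simp
    then show ?thesis
      using T'(3)[of i j j'] True that by simp
  next
    case False
    then have "(i, j) \<in> \<nu>"
      using that by (auto simp: \<mu>_eq)
    then show ?thesis
      using less[of "(i, j)"] False that by simp
  qed
  show "?T (i, j) < ?T (i', j)" if "(i, j) \<in> \<mu>" "(i', j) \<in> \<mu>" "i < i'" for i i' j
  proof (cases "(i', j) \<in> \<nu>")
    case True
    then have "(i, j) \<in> \<nu>"
      using partitionD[OF \<open>\<nu> \<in> partitions\<close>, of i' j i j] that by simp
    then show ?thesis
      using T'(4)[of i j i'] True that by simp
  next
    case False
    then have "(i, j) \<in> \<nu>"
      using that by (auto simp: \<mu>_eq)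
    then show ?thesis
      using less[of "(i, j)"] False that by simp
  qed
qed simp

text \<open>
  Deleting the largest entry is a bijection from the tableaux of shape \<open>\<mu>\<close> to the tableaux of all
  shapes obtained from \<open>\<mu>\<close> by removing one cell.
\<close>
lemma num_syt_down:
  assumes \<mu>: "\<mu> \<in> partitions" "\<mu> \<noteq> {}"
  shows "num_syt \<mu> = (\<Sum>\<nu>\<in>down \<mu>. num_syt \<nu>)"
proof -
  define remove where
    "remove = (\<lambda>T. let \<nu> = {d \<in> \<mu>. T d \<noteq> card \<mu>} in (\<nu>, restrict T \<nu> :: nat \<times> nat \<Rightarrow> nat))"
  define add where
    "add = (\<lambda>(\<nu>, T). \<lambda>d\<in>\<mu>. if d \<in> \<nu> then T d else card \<mu>)"
  have fin: "finite \<mu>" and pos: "card \<mu> > 0"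
    using \<mu> finite_partition by (auto simp: card_gt_0_iff)
  have remove: "remove T \<in> Sigma (down \<mu>) standard_young_tableaux" "add (remove T) = T"
    if T: "T \<in> standard_young_tableaux \<mu>" for T
  proof -
    note T' = standard_young_tableauxD[OF T]
    have "card \<mu> \<in> T ` \<mu>"
      using T'(2) pos by (simp add: bij_betw_def)
    then obtain c where c: "c \<in> \<mu>" "T c = card \<mu>"
      by auto
    then have "{d \<in> \<mu>. T d \<noteq> card \<mu>} = \<mu> - {c}"
      using T'(2) by (fastforce simp: bij_betw_def inj_on_def)
    then have rem: "remove T = (\<mu> - {c}, restrict T (\<mu> - {c}))"
      by (simp add: remove_def Let_def)
    then show "remove T \<in> Sigma (down \<mu>) standard_young_tableaux"
      using standard_young_tableaux_remove_max[OF \<mu>(1) T c] by simp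
    show "add (remove T) = T"
      using c T'(1) by (auto simp: rem add_def fun_eq_iff restrict_def extensional_def)
  qed
  have add: "add (\<nu>, T) \<in> standard_young_tableaux \<mu>" "remove (add (\<nu>, T)) = (\<nu>, T)"
    if \<nu>: "\<nu> \<in> down \<mu>" and T: "T \<in> standard_young_tableaux \<nu>" for \<nu> T
  proof -
    note T' = standard_young_tableauxD[OF T]
    show "add (\<nu>, T) \<in> standard_young_tableaux \<mu>"
      using standard_young_tableaux_add_max[OF \<mu>(1) \<nu> T] by (simp add: add_def)
    have "\<nu> \<subseteq> \<mu>"
      using \<nu> by (auto simp: in_down_iff)
    have "T d \<noteq> card \<mu>" if "d \<in> \<nu>" for d
      using T'(2) that card_down_elem[OF \<mu>(1) \<nu>] by (force simp: bij_betw_def)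
    then have "{d \<in> \<mu>. add (\<nu>, T) d \<noteq> card \<mu>} = \<nu>"
      using \<open>\<nu> \<subseteq> \<mu>\<close> by (auto simp: add_def)
    moreover have "restrict (add (\<nu>, T)) \<nu> = T"
      using T'(1) \<open>\<nu> \<subseteq> \<mu>\<close> by (auto simp: add_def fun_eq_iff restrict_def extensional_def)
    ultimately show "remove (add (\<nu>, T)) = (\<nu>, T)"
      by (simp add: remove_def Let_def)
  qed
  have "bij_betw remove (standard_young_tableaux \<mu>) (Sigma (down \<mu>) standard_young_tableaux)"
  proof (rule bij_betw_byWitness[where f' = add])
    show "remove ` standard_young_tableaux \<mu> \<subseteq> Sigma (down \<mu>) standard_young_tableaux"
      by (rule image_subsetI, rule remove(1))
  qed (auto simp: remove(2) add)
  then have "num_syt \<mu> = card (Sigma (down \<mu>) standard_young_tableaux)"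
    unfolding num_syt_def by (rule bij_betw_same_card)
  also have "\<dots> = (\<Sum>\<nu>\<in>down \<mu>. num_syt \<nu>)"
    unfolding num_syt_def
    by (rule card_SigmaI)
      (use \<mu> in \<open>auto simp: finite_down in_down_iff intro: finite_standard_young_tableaux\<close>)
  finally show ?thesis .
qed

text \<open>
  Expanding each \<open>f\<^sup>\<mu>\<close> over the lower neighbours of \<open>\<mu>\<close> and exchanging the two steps reduces the
  claim for \<open>\<nu>\<close> to the claim for the lower neighbours of \<open>\<nu>\<close>.
\<close>
lemma num_syt_up:
  assumes "\<nu> \<in> partitions"
  shows "(\<Sum>\<mu>\<in>up \<nu>. num_syt \<mu>) = Suc (card \<nu>) * num_syt \<nu>"
  using assms
proof (induction "card \<nu>" arbitrary: \<nu> rule: less_induct)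
  case less
  have "(\<Sum>\<mu>\<in>up \<nu>. num_syt \<mu>) = (\<Sum>\<mu>\<in>up \<nu>. \<Sum>\<nu>'\<in>down \<mu>. num_syt \<nu>')"
    by (rule sum.cong[OF refl], rule num_syt_down) (auto simp: in_up_iff)
  also have "\<dots> = num_syt \<nu> + (\<Sum>\<kappa>\<in>down \<nu>. \<Sum>\<nu>'\<in>up \<kappa>. num_syt \<nu>')"
    using less.prems by (rule sum_up_down_commute)
  also have "(\<Sum>\<kappa>\<in>down \<nu>. \<Sum>\<nu>'\<in>up \<kappa>. num_syt \<nu>') = (\<Sum>\<kappa>\<in>down \<nu>. card \<nu> * num_syt \<kappa>)"
  proof (rule sum.cong[OF refl])
    fix \<kappa> assume \<kappa>: "\<kappa> \<in> down \<nu>"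
    then have "card \<nu> = Suc (card \<kappa>)" "\<kappa> \<in> partitions"
      using card_down_elem[OF less.prems] by (auto simp: in_down_iff)
    then show "(\<Sum>\<nu>'\<in>up \<kappa>. num_syt \<nu>') = card \<nu> * num_syt \<kappa>"
      using less.hyps[of \<kappa>] by simp
  qed
  also have "\<dots> = card \<nu> * num_syt \<nu>"
    using num_syt_down[OF less.prems] by (cases "\<nu> = {}") (simp_all add: sum_distrib_left)
  finally show ?case
    by simp
qed

section \<open>Vacillating tableaux\<close>

lemma num_vacillating_0: "num_vacillating 0 \<mu> = (if \<mu> = {} then 1 else 0)"
proof -
  have "vacillating_tableaux 0 \<mu> = (if \<mu> = {} then {[{}]} else {})"
    using empty_partition
    by (auto simp: vacillating_tableaux_def length_Suc_conv)
  then show ?thesis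
    by (simp add: num_vacillating_def)
qed

lemma vacillating_tableaux_partition:
  assumes "\<nu> \<in> vacillating_tableaux k \<mu>"
  shows "\<mu> \<in> partitions"
proof -
  have "length \<nu> = 2 * k + 1" "set \<nu> \<subseteq> partitions" "\<nu> ! (2 * k) = \<mu>"
    using assms by (simp_all add: vacillating_tableaux_def)
  then show ?thesis
    using nth_mem[of "2 * k" \<nu>] by auto
qed

lemma stay_or_up_iff:
  assumes "\<nu> \<in> partitions"
  shows "\<mu> \<in> insert \<nu> (up \<nu>) \<longleftrightarrow> \<mu> \<in> partitions \<and> \<nu> \<subseteq> \<mu> \<and> card (\<mu> - \<nu>) \<in> {0, 1}"
  using assms finite_partition by (auto simp: up_def)

lemma stay_or_down_iff:
  assumes "\<mu> \<in> partitions"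
  shows "\<nu> \<in> insert \<mu> (down \<mu>) \<longleftrightarrow> \<nu> \<in> partitions \<and> \<nu> \<subseteq> \<mu> \<and> card (\<mu> - \<nu>) \<in> {0, 1}"
  using assms finite_partition by (auto simp: down_def)

text \<open>
  The last two half steps are recorded by the shapes \<open>\<nu>\<close> and \<open>\<kappa>\<close> with indices \<open>k + 1/2\<close> and \<open>k\<close>.
\<close>
lemma vacillating_tableaux_Suc:
  assumes \<mu>: "\<mu> \<in> partitions"
  shows "vacillating_tableaux (Suc k) \<mu> =
    (\<lambda>(\<nu>, \<kappa>, xs). xs @ [\<nu>, \<mu>]) `
      (SIGMA \<nu> : insert \<mu> (down \<mu>). SIGMA \<kappa> : insert \<nu> (up \<nu>). vacillating_tableaux k \<kappa>)"
    (is "?L = ?f ` ?R")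
proof (intro set_eqI iffI)
  fix ys assume ys: "ys \<in> ?L"
  define xs where "xs = take (2 * k + 1) ys"
  define \<nu> where "\<nu> = ys ! (2 * k + 1)"
  define \<kappa> where "\<kappa> = ys ! (2 * k)"
  have len: "length ys = 2 * k + 3" and parts: "set ys \<subseteq> partitions"
    and steps: "\<And>j. j < Suc k \<Longrightarrow>
        ys ! (2 * j + 1) \<subseteq> ys ! (2 * j) \<and>
        card (ys ! (2 * j) - ys ! (2 * j + 1)) \<in> {0, 1} \<and>
        ys ! (2 * j + 1) \<subseteq> ys ! (2 * j + 2) \<and>
        card (ys ! (2 * j + 2) - ys ! (2 * j + 1)) \<in> {0, 1}"
    and ends: "ys ! 0 = {}" "ys ! (2 * k + 2) = \<mu>"
    using ys by (simp_all add: vacillating_tableaux_def)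
  have ys_eq: "ys = xs @ [\<nu>, \<mu>]"
  proof (rule nth_equalityI)
    show "length ys = length (xs @ [\<nu>, \<mu>])"
      by (simp add: len xs_def)
    fix i assume "i < length ys"
    then consider "i < 2 * k + 1" | "i = 2 * k + 1" | "i = 2 * k + 2"
      by (force simp: len)
    then show "ys ! i = (xs @ [\<nu>, \<mu>]) ! i"
      by cases (simp_all add: nth_append len xs_def \<nu>_def ends[simplified])
  qed
  have "\<nu> \<in> partitions" "\<kappa> \<in> partitions"
    using parts len nth_mem[of "2 * k + 1" ys] nth_mem[of "2 * k" ys]
    by (auto simp: \<nu>_def \<kappa>_def)
  then have "\<nu> \<in> insert \<mu> (down \<mu>)" "\<kappa> \<in> insert \<nu> (up \<nu>)"
    using steps[of k] unfolding stay_or_down_iff[OF \<mu>] stay_or_up_iff[OF \<open>\<nu> \<in> partitions\<close>]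
    by (simp_all add: \<nu>_def \<kappa>_def ends[simplified])
  moreover have "xs \<in> vacillating_tableaux k \<kappa>"
    using steps parts ends len set_take_subset[of "2 * k + 1" ys]
    by (auto simp: vacillating_tableaux_def xs_def \<kappa>_def)
  ultimately show "ys \<in> ?f ` ?R"
    by (intro image_eqI[where x = "(\<nu>, \<kappa>, xs)"]) (simp_all add: ys_eq)
next
  fix ys assume "ys \<in> ?f ` ?R"
  then obtain \<nu> \<kappa> xs where \<nu>: "\<nu> \<in> insert \<mu> (down \<mu>)" and \<kappa>: "\<kappa> \<in> insert \<nu> (up \<nu>)"
    and xs: "xs \<in> vacillating_tableaux k \<kappa>" and ys: "ys = xs @ [\<nu>, \<mu>]"
    by auto
  have \<nu>': "\<nu> \<in> partitions" "\<nu> \<subseteq> \<mu>" "card (\<mu> - \<nu>) \<in> {0, 1}"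
    using \<nu> unfolding stay_or_down_iff[OF \<mu>] by auto
  have \<kappa>': "\<nu> \<subseteq> \<kappa>" "card (\<kappa> - \<nu>) \<in> {0, 1}"
    using \<kappa> unfolding stay_or_up_iff[OF \<nu>'(1)] by auto
  have len: "length xs = 2 * k + 1" and "xs ! (2 * k) = \<kappa>"
    using xs by (auto simp: vacillating_tableaux_def)
  have "ys ! (2 * j + 1) \<subseteq> ys ! (2 * j) \<and>
        card (ys ! (2 * j) - ys ! (2 * j + 1)) \<in> {0, 1} \<and>
        ys ! (2 * j + 1) \<subseteq> ys ! (2 * j + 2) \<and>
        card (ys ! (2 * j + 2) - ys ! (2 * j + 1)) \<in> {0, 1}" if "j < Suc k" for j
  proof (cases "j = k")
    case True
    then show ?thesis
      using \<nu>' \<kappa>' \<open>xs ! (2 * k) = \<kappa>\<close> by (simp add: ys nth_append len)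
  next
    case False
    then have "j < k"
      using that by simp
    then show ?thesis
      using xs by (simp add: vacillating_tableaux_def ys nth_append)
  qed
  then show "ys \<in> ?L"
    using xs \<mu> \<nu>'(1) by (simp add: vacillating_tableaux_def ys nth_append)
qed

lemma finite_vacillating_tableaux: "finite (vacillating_tableaux k \<mu>)"
proof (induction k arbitrary: \<mu>)
  case 0
  show ?case
    by (rule finite_subset[of _ "{[{}]}"]) (auto simp: vacillating_tableaux_def length_Suc_conv)
next
  case (Suc k)
  show ?case
  proof (cases "\<mu> \<in> partitions")
    case True
    have "finite (insert \<nu> (up \<nu>))" if "\<nu> \<in> insert \<mu> (down \<mu>)" for \<nu>
      using that True by (auto simp: in_down_iff finite_up)
    then show ?thesis
      unfolding vacillating_tableaux_Suc[OF True]
      by (intro finite_imageI finite_SigmaI Suc.IH) (simp_all add: finite_down True)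
  next
    case False
    then have "vacillating_tableaux (Suc k) \<mu> = {}"
      using vacillating_tableaux_partition by blast
    then show ?thesis
      by simp
  qed
qed

text \<open>
  The number of sequences that end with \<open>\<nu>\<close> at the half-integer index \<open>k + 1/2\<close>.
\<close>
definition num_half_vacillating :: "nat \<Rightarrow> diagram \<Rightarrow> nat" where
  "num_half_vacillating k \<nu> = num_vacillating k \<nu> + (\<Sum>\<kappa>\<in>up \<nu>. num_vacillating k \<kappa>)"

lemma num_vacillating_Suc:
  assumes \<mu>: "\<mu> \<in> partitions"
  shows "num_vacillating (Suc k) \<mu> =
    num_half_vacillating k \<mu> + (\<Sum>\<nu>\<in>down \<mu>. num_half_vacillating k \<nu>)"
proof -
  have irrefl: "\<nu> \<notin> up \<nu>" "\<nu> \<notin> down \<nu>" for \<nu>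
    by (auto simp: up_def down_def)
  have inj: "inj_on (\<lambda>(\<nu>, \<kappa>, xs). xs @ [\<nu>, \<mu>])
      (SIGMA \<nu> : insert \<mu> (down \<mu>). SIGMA \<kappa> : insert \<nu> (up \<nu>). vacillating_tableaux k \<kappa>)"
    by (auto simp: inj_on_def vacillating_tableaux_def)
  have fin: "finite (insert \<nu> (up \<nu>))" if "\<nu> \<in> insert \<mu> (down \<mu>)" for \<nu>
    using that \<mu> by (auto simp: in_down_iff finite_up)
  have half: "card (SIGMA \<kappa> : insert \<nu> (up \<nu>). vacillating_tableaux k \<kappa>) = num_half_vacillating k \<nu>"
    if "\<nu> \<in> insert \<mu> (down \<mu>)" for \<nu>
  proof -
    have "card (SIGMA \<kappa> : insert \<nu> (up \<nu>). vacillating_tableaux k \<kappa>) =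
        (\<Sum>\<kappa>\<in>insert \<nu> (up \<nu>). num_vacillating k \<kappa>)"
      unfolding num_vacillating_def
      using fin[OF that] by (intro card_SigmaI) (auto simp: finite_vacillating_tableaux)
    then show ?thesis
      using fin[OF that] by (simp add: num_half_vacillating_def irrefl)
  qed
  have "num_vacillating (Suc k) \<mu> = card
      (SIGMA \<nu> : insert \<mu> (down \<mu>). SIGMA \<kappa> : insert \<nu> (up \<nu>). vacillating_tableaux k \<kappa>)"
    unfolding num_vacillating_def vacillating_tableaux_Suc[OF \<mu>] using inj by (rule card_image)
  also have "\<dots> = (\<Sum>\<nu>\<in>insert \<mu> (down \<mu>).
      card (SIGMA \<kappa> : insert \<nu> (up \<nu>). vacillating_tableaux k \<kappa>))"
    by (rule card_SigmaI)
      (auto intro!: finite_SigmaI fin finite_vacillating_tableaux simp: finite_down \<mu>)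
  also have "\<dots> = (\<Sum>\<nu>\<in>insert \<mu> (down \<mu>). num_half_vacillating k \<nu>)"
    by (rule sum.cong[OF refl half])
  finally show ?thesis
    by (simp add: finite_down \<mu> irrefl)
qed

text \<open>
  A full step adds at most one cell.  This bounds the support of the infinite sum in \<open>u\<close>.
\<close>
lemma num_vacillating_eq_0:
  assumes "\<mu> \<in> partitions" "card \<mu> > k"
  shows "num_vacillating k \<mu> = 0"
  using assms
proof (induction k arbitrary: \<mu>)
  case 0
  then show ?case
    by (auto simp: num_vacillating_0)
next
  case (Suc k)
  have half: "num_half_vacillating k \<nu> = 0" if "\<nu> \<in> partitions" "card \<nu> > k" for \<nu>
    using that Suc.IH by (auto simp: num_half_vacillating_def card_up_elem in_up_iff)
  have "num_half_vacillating k \<nu> = 0" if "\<nu> \<in> down \<mu>" for \<nu>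
    using card_down_elem[OF Suc.prems(1) that] Suc.prems(2) that
    by (intro half) (auto simp: in_down_iff)
  then show ?case
    using Suc.prems half by (simp add: num_vacillating_Suc)
qed

section \<open>Vacillating tableaux weighted by standard Young tableaux\<close>

lemma sum_up_swap:
  fixes F :: "diagram \<Rightarrow> diagram \<Rightarrow> nat"
  shows "(\<Sum>\<nu>\<in>partitions_of_size n. \<Sum>\<mu>\<in>up \<nu>. F \<nu> \<mu>) =
    (\<Sum>\<mu>\<in>partitions_of_size (Suc n). \<Sum>\<nu>\<in>down \<mu>. F \<nu> \<mu>)"
proof -
  have "(\<Sum>(\<nu>, \<mu>)\<in>Sigma (partitions_of_size n) up. F \<nu> \<mu>) =
      (\<Sum>(\<mu>, \<nu>)\<in>Sigma (partitions_of_size (Suc n)) down. F \<nu> \<mu>)"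
    by (rule sum.reindex_bij_witness[where i = prod.swap and j = prod.swap])
      (auto simp: partitions_of_size_def card_up_elem dest: card_down_elem
        up_down_iff[THEN iffD1, OF conjI] up_down_iff[THEN iffD2, OF conjI])
  moreover have "\<forall>\<nu>\<in>partitions_of_size n. finite (up \<nu>)"
    and "\<forall>\<mu>\<in>partitions_of_size (Suc n). finite (down \<mu>)"
    by (simp_all add: partitions_of_size_def finite_up finite_down)
  ultimately show ?thesis
    by (simp only: sum.Sigma finite_partitions_of_size)
qed

definition tableau_weight :: "nat \<Rightarrow> nat \<Rightarrow> nat" where
  "tableau_weight k n = (\<Sum>\<mu>\<in>partitions_of_size n. num_vacillating k \<mu> * num_syt \<mu>)"

lemma tableau_weight_0: "tableau_weight 0 n = (if n = 0 then 1 else 0)"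
proof -
  have "tableau_weight 0 n = (\<Sum>\<mu>\<in>partitions_of_size n. if \<mu> = {} then 1 else 0)"
    unfolding tableau_weight_def by (rule sum.cong[OF refl]) (simp add: num_vacillating_0 num_syt_empty)
  also have "\<dots> = (if n = 0 then 1 else 0)"
    by (simp add: finite_partitions_of_size) (auto simp: partitions_of_size_def empty_partition)
  finally show ?thesis .
qed

text \<open>
  A shape \<open>\<kappa>\<close> of size \<open>n + 1\<close> passes on its whole weight when a cell is removed, since \<open>f\<^sup>\<kappa>\<close> is the
  sum of \<open>f\<^sup>\<nu>\<close> over the shapes \<open>\<nu>\<close> so obtained; shapes of size \<open>n\<close> may stay as they are.
\<close>
lemma tableau_weight_half:
  "(\<Sum>\<nu>\<in>partitions_of_size n. num_half_vacillating k \<nu> * num_syt \<nu>) =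
    tableau_weight k n + tableau_weight k (Suc n)"
proof -
  have "(\<Sum>\<nu>\<in>partitions_of_size n. \<Sum>\<kappa>\<in>up \<nu>. num_vacillating k \<kappa> * num_syt \<nu>) =
      (\<Sum>\<kappa>\<in>partitions_of_size (Suc n). \<Sum>\<nu>\<in>down \<kappa>. num_vacillating k \<kappa> * num_syt \<nu>)"
    by (rule sum_up_swap)
  also have "\<dots> = tableau_weight k (Suc n)"
    unfolding tableau_weight_def
    by (rule sum.cong[OF refl], subst num_syt_down) (auto simp: partitions_of_size_def sum_distrib_left)
  finally show ?thesis
    by (simp add: num_half_vacillating_def tableau_weight_def add_mult_distrib sum.distrib
        sum_distrib_right)
qed

text \<open>
  The half step that may add a cell contributes the factor \<open>n\<close> of \<open>num_syt_up\<close> when it leads to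
  size \<open>n\<close>.  For \<open>n = 0\<close> the truncated index \<open>n - 1\<close> comes with the factor 0.
\<close>
lemma tableau_weight_Suc:
  "tableau_weight (Suc k) n =
    tableau_weight k (Suc n) + Suc n * tableau_weight k n + n * tableau_weight k (n - 1)"
proof -
  let ?h = "num_half_vacillating k"
  have "tableau_weight (Suc k) n =
      (\<Sum>\<mu>\<in>partitions_of_size n. ?h \<mu> * num_syt \<mu> + (\<Sum>\<nu>\<in>down \<mu>. ?h \<nu> * num_syt \<mu>))"
    unfolding tableau_weight_def
    by (rule sum.cong[OF refl])
      (simp add: partitions_of_size_def num_vacillating_Suc add_mult_distrib sum_distrib_right)
  also have "\<dots> = tableau_weight k n + tableau_weight k (Suc n) +
      (\<Sum>\<mu>\<in>partitions_of_size n. \<Sum>\<nu>\<in>down \<mu>. ?h \<nu> * num_syt \<mu>)"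
    by (simp add: sum.distrib tableau_weight_half)
  also have "(\<Sum>\<mu>\<in>partitions_of_size n. \<Sum>\<nu>\<in>down \<mu>. ?h \<nu> * num_syt \<mu>) =
      n * (tableau_weight k (n - 1) + tableau_weight k n)"
  proof (cases n)
    case 0
    have "down \<mu> = {}" if "\<mu> \<in> partitions_of_size 0" for \<mu>
      using that card_down_elem by (fastforce simp: partitions_of_size_def)
    then show ?thesis
      by (simp add: 0)
  next
    case (Suc m)
    have "(\<Sum>\<mu>\<in>partitions_of_size (Suc m). \<Sum>\<nu>\<in>down \<mu>. ?h \<nu> * num_syt \<mu>) =
        (\<Sum>\<nu>\<in>partitions_of_size m. \<Sum>\<mu>\<in>up \<nu>. ?h \<nu> * num_syt \<mu>)"
      by (rule sum_up_swap[symmetric])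
    also have "\<dots> = (\<Sum>\<nu>\<in>partitions_of_size m. Suc m * (?h \<nu> * num_syt \<nu>))"
      by (rule sum.cong[OF refl])
        (auto simp: partitions_of_size_def sum_distrib_left[symmetric] num_syt_up simp del: mult_Suc)
    also have "\<dots> = Suc m * (tableau_weight k m + tableau_weight k (Suc m))"
      by (simp only: sum_distrib_left[symmetric] tableau_weight_half)
    finally show ?thesis
      by (simp add: Suc)
  qed
  finally show ?thesis
    by (simp add: algebra_simps)
qed

lemma u_eq_sum_tableau_weight: "u k = (\<Sum>n\<le>k. tableau_weight k n)"
proof -
  have "u k = infsum (\<lambda>\<mu>. num_vacillating k \<mu> * num_syt \<mu>) (\<Union>n\<le>k. partitions_of_size n)"
    unfolding u_def
    by (rule infsum_cong_neutral) (auto simp: partitions_of_size_def not_le num_vacillating_eq_0)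
  also have "\<dots> = (\<Sum>\<mu>\<in>(\<Union>n\<le>k. partitions_of_size n). num_vacillating k \<mu> * num_syt \<mu>)"
    by (rule infsum_finite) (simp add: finite_partitions_of_size)
  also have "\<dots> = (\<Sum>n\<le>k. tableau_weight k n)"
    unfolding tableau_weight_def
    by (rule sum.UNION_disjoint) (auto simp: finite_partitions_of_size, auto simp: partitions_of_size_def)
  finally show ?thesis .
qed

section \<open>Linear orders on a finite set\<close>

text \<open>
  A linear order on a nonempty finite set amounts to the choice of its greatest element \<open>x\<close> and of a
  linear order on the other elements.
\<close>
lemma linear_orders_decompose:
  assumes "finite M" "M \<noteq> {}"
  shows "bij_betw (\<lambda>(x, r). r \<union> M \<times> {x})
    (SIGMA x : M. {r. linear_order_on (M - {x}) r}) {r. linear_order_on M r}"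
    (is "bij_betw ?f ?D ?L")
proof (rule bij_betwI')
  fix y z assume "y \<in> ?D" "z \<in> ?D"
  then obtain x r x' r' where y: "y = (x, r)" "x \<in> M" "r \<subseteq> (M - {x}) \<times> (M - {x})"
    and z: "z = (x', r')" "x' \<in> M" "r' \<subseteq> (M - {x'}) \<times> (M - {x'})"
    by (auto simp: order_on_defs)
  show "?f y = ?f z \<longleftrightarrow> y = z"
  proof
    assume "?f y = ?f z"
    then have eq: "r \<union> M \<times> {x} = r' \<union> M \<times> {x'}"
      by (simp add: y z)
    have "(x', x) \<in> r' \<union> M \<times> {x'}"
      using y z unfolding eq[symmetric] by blast
    then have "x = x'"
      using z by blast
    moreover have "r = (r \<union> M \<times> {x}) \<inter> (M - {x}) \<times> (M - {x})"
      "r' = (r' \<union> M \<times> {x'}) \<inter> (M - {x'}) \<times> (M - {x'})"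
      using y z by blast+
    ultimately show "y = z"
      using eq y z by simp
  qed simp
next
  fix y assume "y \<in> ?D"
  then obtain x r where y: "y = (x, r)" "x \<in> M" and r: "linear_order_on (M - {x}) r"
    by auto
  have sub: "r \<subseteq> (M - {x}) \<times> (M - {x})" and refl: "refl_on (M - {x}) r"
    and trans: "trans r" and antisym: "antisym r" and total: "total_on (M - {x}) r"
    using r by (simp_all add: order_on_defs)
  have "linear_order_on M (r \<union> M \<times> {x})"
    unfolding order_on_defs
  proof (intro conjI)
    show "r \<union> M \<times> {x} \<subseteq> M \<times> M"
      using sub y by blast
    show "refl_on M (r \<union> M \<times> {x})"
      using refl by (auto simp: refl_on_def)
    show "trans (r \<union> M \<times> {x})"
      using sub by (auto intro!: transI dest: transD[OF trans])
    show "antisym (r \<union> M \<times> {x})"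
      using sub by (auto intro!: antisymI dest: antisymD[OF antisym])
    show "total_on M (r \<union> M \<times> {x})"
      using total y by (auto simp: total_on_def)
  qed
  then show "?f y \<in> ?L"
    by (simp add: y)
next
  fix r assume "r \<in> ?L"
  then have r: "linear_order_on M r"
    by simp
  have sub: "r \<subseteq> M \<times> M" and refl: "refl_on M r"
    and trans: "trans r" and antisym: "antisym r" and total: "total_on M r"
    using r by (simp_all add: order_on_defs)
  have "linear_order_on M (r\<inverse>)"
    using r by simp
  moreover have "finite (r\<inverse>)"
    using sub assms(1) by (simp add: finite_subset)
  ultimately have "wf (r\<inverse> - Id)"
    using linear_order_on_well_order_on well_order_on_def by blast
  then obtain x where x: "x \<in> M" "\<And>y. (y, x) \<in> r\<inverse> - Id \<Longrightarrow> y \<notin> M"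
    using assms(2) by (meson all_not_in_conv wfE_min)
  have max: "(y, x) \<in> r" if "y \<in> M" for y
  proof (cases "y = x")
    case True
    then show ?thesis
      using refl that by (auto simp: refl_on_def)
  next
    case False
    then show ?thesis
      using total x that by (auto simp: total_on_def)
  qed
  have "linear_order_on (M - {x}) (Restr r (M - {x}))"
    using refl trans antisym total
    unfolding order_on_defs refl_on_def trans_def antisym_def total_on_def by blast
  moreover have "r = Restr r (M - {x}) \<union> M \<times> {x}"
    using sub max x by blast
  ultimately show "\<exists>y\<in>?D. r = ?f y"
    using x(1) by (intro bexI[of _ "(x, Restr r (M - {x}))"]) simp_all
qed

lemma finite_linear_orders: "finite M \<Longrightarrow> finite {r. linear_order_on M r}"
  by (rule finite_subset[of _ "Pow (M \<times> M)"]) (auto simp: order_on_defs)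

lemma card_linear_orders:
  assumes "finite M"
  shows "card {r. linear_order_on M r} = fact (card M)"
  using assms
proof (induction "card M" arbitrary: M)
  case 0
  have "{r. linear_order_on ({} :: 'a set) r} = {{}}"
    by (auto simp: order_on_defs)
  then show ?case
    using 0 by simp
next
  case (Suc n)
  then have "M \<noteq> {}"
    by auto
  have "card {r. linear_order_on M r} = card (SIGMA x : M. {r. linear_order_on (M - {x}) r})"
    using linear_orders_decompose[OF Suc.prems \<open>M \<noteq> {}\<close>] by (simp add: bij_betw_same_card)
  also have "\<dots> = (\<Sum>x\<in>M. card {r. linear_order_on (M - {x}) r})"
    using Suc.prems by (intro card_SigmaI) (simp_all add: finite_linear_orders)
  also have "\<dots> = (\<Sum>x\<in>M. fact n)"
  proof (rule sum.cong[OF refl])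
    fix x assume "x \<in> M"
    then have "card (M - {x}) = n"
      using Suc.hyps(2) Suc.prems by simp
    then show "card {r. linear_order_on (M - {x}) r} = fact n"
      using Suc.hyps(1)[of "M - {x}"] Suc.prems by simp
  qed
  also have "\<dots> = fact (card M)"
    by (simp add: Suc.hyps(2)[symmetric])
  finally show ?case .
qed

section \<open>Partly ordered set partitions\<close>

text \<open>
  A partition of \<open>insert x S\<close> arises from a unique partition \<open>P\<close> of \<open>S\<close>, either by adding the new
  block \<open>{x}\<close> or by inserting \<open>x\<close> into one of the blocks of \<open>P\<close>.
\<close>
lemma sum_partition_on_insert:
  fixes F :: "nat \<Rightarrow> nat"
  assumes S: "finite S" "x \<notin> S"
  shows "(\<Sum>Q | partition_on (insert x S) Q. F (card Q)) =
    (\<Sum>P | partition_on S P. F (Suc (card P)) + card P * F (card P))"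
proof -
  let ?parts = "\<lambda>A. {P. partition_on A P}"
  have fin: "finite P" "x \<notin> \<Union>P" "{} \<notin> P" "disjoint P" if "P \<in> ?parts S" for P
    using that S finite_elements by (auto simp: partition_on_def)
  define old where "old = {Q \<in> ?parts (insert x S). {x} \<notin> Q}"
  define new where "new = {Q \<in> ?parts (insert x S). {x} \<in> Q}"
  have "(\<Sum>Q\<in>new. F (card Q)) = (\<Sum>P\<in>?parts S. F (Suc (card P)))"
  proof (rule sum.reindex_bij_witness[where i = "insert {x}" and j = "\<lambda>Q. Q - {{x}}"])
    fix Q assume "Q \<in> new"
    then have Q: "partition_on (insert x S) Q" "{x} \<in> Q"
      by (auto simp: new_def)
    show "insert {x} (Q - {{x}}) = Q"
      using Q by auto
    have "C \<inter> {x} = {}" if "C \<in> Q" "C \<noteq> {x}" for C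
      using Q that by (intro disjointD[of Q]) (auto simp: partition_on_def)
    then have "disjnt {x} (\<Union>(Q - {{x}}))"
      by (auto simp: disjnt_def)
    then show "Q - {{x}} \<in> ?parts S"
      using Q S partition_on_insert[of "{x}" "Q - {{x}}" "insert x S"]
      by (simp add: insert_absorb)
    then show "F (Suc (card (Q - {{x}}))) = F (card Q)"
      using Q fin by (metis card_Suc_Diff1 finite_insert insert_Diff)
  next
    fix P assume P: "P \<in> ?parts S"
    have "{x} \<notin> P"
      using fin(2)[OF P] by auto
    then show "insert {x} P - {{x}} = P"
      by simp
    have "disjnt {x} (\<Union>P)"
      using fin(2)[OF P] by (simp add: disjnt_def)
    then show "insert {x} P \<in> new"
      using P S partition_on_insert[of "{x}" P "insert x S"] by (simp add: new_def)
  qed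
  moreover have "(\<Sum>Q\<in>old. F (card Q)) = (\<Sum>(P, B)\<in>(SIGMA P : ?parts S. P). F (card P))"
  proof (rule sum.reindex_bij_witness[where
        i = "\<lambda>(P, B). insert (insert x B) (P - {B})" and
        j = "\<lambda>Q. ((\<lambda>C. C - {x}) ` Q, \<Union>{C \<in> Q. x \<in> C} - {x})"])
    \<comment> \<open>Deleting \<open>x\<close> from every block recovers \<open>P\<close>; only the block \<open>C\<close> of \<open>x\<close> is changed.\<close>
    fix Q assume "Q \<in> old"
    then have Q: "partition_on (insert x S) Q" "{x} \<notin> Q"
      by (auto simp: old_def)
    then obtain C where C: "C \<in> Q" "x \<in> C"
      by (auto simp: partition_on_def)
    have other: "x \<notin> D" if "D \<in> Q" "D \<noteq> C" for D
      using that C Q by (auto simp: partition_on_def disjoint_def)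
    define B where "B = C - {x}"
    have C_eq: "C = insert x B" "x \<notin> B"
      using C by (auto simp: B_def)
    have "B \<noteq> {}"
      using Q C C_eq by auto
    have "B \<notin> Q"
    proof
      assume "B \<in> Q"
      then have "B \<inter> C = {}"
        using Q C C_eq(2) by (auto simp: partition_on_def disjoint_def)
      then show False
        using \<open>B \<noteq> {}\<close> C_eq by auto
    qed
    have "(\<lambda>D. D - {x}) ` (Q - {C}) = Q - {C}"
      using other by force
    then have image: "(\<lambda>D. D - {x}) ` Q = insert B (Q - {C})"
      using C by (metis B_def image_insert insert_Diff)
    have "{D \<in> Q. x \<in> D} = {C}"
      using C other by auto
    then have j: "((\<lambda>D. D - {x}) ` Q, \<Union>{D \<in> Q. x \<in> D} - {x}) = (insert B (Q - {C}), B)"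
      by (simp add: image B_def)
    have "insert (insert x B) (insert B (Q - {C}) - {B}) = Q"
      using C C_eq \<open>B \<notin> Q\<close> by auto
    then show "(case ((\<lambda>D. D - {x}) ` Q, \<Union>{D \<in> Q. x \<in> D} - {x}) of
        (P, B) \<Rightarrow> insert (insert x B) (P - {B})) = Q"
      unfolding j by simp
    have disj: "disjnt C (\<Union>(Q - {C}))"
      using Q C by (auto simp: partition_on_def disjoint_def disjnt_iff)
    then have rest: "partition_on (insert x S - C) (Q - {C})" "C \<subseteq> insert x S"
      using Q C partition_on_insert[of C "Q - {C}" "insert x S"] by (simp_all add: insert_absorb)
    have "insert x S - C = S - B" "B \<subseteq> S"
      using C_eq rest S by auto
    moreover have "disjnt B (\<Union>(Q - {C}))"
      using disj C_eq by (auto simp: disjnt_def)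
    ultimately have P: "partition_on S (insert B (Q - {C}))"
      using rest \<open>B \<noteq> {}\<close> partition_on_insert[of B "Q - {C}" S] by simp
    then show "((\<lambda>D. D - {x}) ` Q, \<Union>{D \<in> Q. x \<in> D} - {x}) \<in> (SIGMA P : ?parts S. P)"
      unfolding j by simp
    have "finite Q"
      using Q S finite_elements[of "insert x S"] by simp
    then have "card (insert B (Q - {C})) = card Q"
      using \<open>finite Q\<close> \<open>B \<notin> Q\<close> card_Suc_Diff1[OF \<open>finite Q\<close> C(1)] by simp
    then show "(case ((\<lambda>D. D - {x}) ` Q, \<Union>{D \<in> Q. x \<in> D} - {x}) of (P, B) \<Rightarrow> F (card P)) = F (card Q)"
      unfolding j by simp
  next
    fix y assume "y \<in> (SIGMA P : ?parts S. P)"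
    then obtain P B where y: "y = (P, B)" and P: "P \<in> ?parts S" "B \<in> P"
      by auto
    define Q where "Q = insert (insert x B) (P - {B})"
    have x: "x \<notin> D" if "D \<in> P" for D
      using fin(2)[OF P(1)] that by auto
    have "B \<noteq> {}" and "insert x B \<notin> P"
      using fin(3)[OF P(1)] P(2) x by auto
    have "(\<lambda>C. C - {x}) ` (P - {B}) = P - {B}"
      using x by force
    then have "(\<lambda>C. C - {x}) ` Q = P"
      using x[OF P(2)] P(2) by (auto simp: Q_def)
    moreover have "{C \<in> Q. x \<in> C} = {insert x B}"
      using x by (auto simp: Q_def)
    ultimately show "((\<lambda>C. C - {x}) ` (case y of (P, B) \<Rightarrow> insert (insert x B) (P - {B})),
        \<Union>{C \<in> (case y of (P, B) \<Rightarrow> insert (insert x B) (P - {B})). x \<in> C} - {x}) = y"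
      using x[OF P(2)] by (simp add: y Q_def[symmetric])
    have disj: "disjnt B (\<Union>(P - {B}))"
      using fin(4)[OF P(1)] P(2) by (auto simp: disjoint_def disjnt_iff)
    then have rest: "partition_on (S - B) (P - {B})" "B \<subseteq> S"
      using P partition_on_insert[of B "P - {B}" S] by (simp_all add: insert_absorb)
    have "disjnt (insert x B) (\<Union>(P - {B}))"
      using disj x by (auto simp: disjnt_def)
    moreover have "insert x S - insert x B = S - B"
      using S by auto
    ultimately have "partition_on (insert x S) Q"
      using rest partition_on_insert[of "insert x B" "P - {B}" "insert x S"]
      by (auto simp: Q_def)
    moreover have "{x} \<notin> Q"
      using x \<open>B \<noteq> {}\<close> x[OF P(2)] by (auto simp: Q_def)
    ultimately show "(case y of (P, B) \<Rightarrow> insert (insert x B) (P - {B})) \<in> old"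
      by (simp add: y old_def Q_def)
  qed
  moreover have "(\<Sum>(P, B)\<in>(SIGMA P : ?parts S. P). F (card P)) = (\<Sum>P\<in>?parts S. card P * F (card P))"
    using fin(1) by (subst sum.Sigma[symmetric]) (simp_all add: finitely_many_partition_on S)
  moreover have "(\<Sum>Q\<in>?parts (insert x S). F (card Q)) = (\<Sum>Q\<in>new. F (card Q)) + (\<Sum>Q\<in>old. F (card Q))"
  proof -
    have "?parts (insert x S) = new \<union> old" "new \<inter> old = {}"
      by (auto simp: new_def old_def)
    moreover have "finite (?parts (insert x S))"
      using S by (simp add: finitely_many_partition_on)
    ultimately show ?thesis
      by (simp add: sum.union_disjoint)
  qed
  ultimately show ?thesis
    by (simp add: sum.distrib)
qed

text \<open>
  The number of partly ordered set partitions of \<open>{1..k}\<close> with exactly \<open>n\<close> marked blocks: for each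
  set partition, choose the marked blocks and then one of their \<open>n!\<close> orders.
\<close>
definition num_marked_partitions :: "nat \<Rightarrow> nat \<Rightarrow> nat" where
  "num_marked_partitions k n = (\<Sum>P | partition_on {1..k} P. fact n * (card P choose n))"

lemma num_marked_partitions_0: "num_marked_partitions 0 n = (if n = 0 then 1 else 0)"
  by (simp add: num_marked_partitions_def partition_on_empty)

text \<open>
  Here \<open>fact n * (p choose n)\<close> is the falling factorial of length \<open>n\<close>.  The left-hand side is what
  the recursion over set partitions yields for a partition with \<open>p\<close> blocks.
\<close>
lemma fact_times_binomial_recurrence:
  "fact n * (Suc p choose n) + p * (fact n * (p choose n)) =
    fact (Suc n) * (p choose Suc n) + Suc n * (fact n * (p choose n)) +
    n * (fact (n - 1) * (p choose (n - 1)) :: nat)"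
proof (cases n)
  case (Suc m)
  \<comment> \<open>Absorption removes the factor \<open>p\<close>, which does not occur on the right-hand side.\<close>
  have "Suc n * ((p choose n) + (p choose Suc n)) = Suc p * (p choose n)"
    using Suc_times_binomial[of n p] by simp
  then have absorb: "Suc n * (p choose Suc n) + n * (p choose n) = p * (p choose n)"
    by (simp add: algebra_simps)
  have "fact n * (Suc p choose n) + p * (fact n * (p choose n)) =
      fact n * ((p choose m) + (p choose n) + p * (p choose n))"
    by (simp add: Suc algebra_simps)
  also have "\<dots> = fact n * (p choose m) + fact n * (Suc n * (p choose Suc n)) +
      Suc n * (fact n * (p choose n))"
    unfolding absorb[symmetric] by (simp add: algebra_simps)
  also have "fact n * (Suc n * (p choose Suc n)) = fact (Suc n) * (p choose Suc n)"
    by (simp only: fact_Suc of_nat_id mult.assoc mult.left_commute)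
  also have "fact n * (p choose m) = n * (fact (n - 1) * (p choose (n - 1)))"
    by (simp add: Suc algebra_simps)
  finally show ?thesis
    by simp
qed simp

lemma num_marked_partitions_Suc:
  "num_marked_partitions (Suc k) n =
    num_marked_partitions k (Suc n) + Suc n * num_marked_partitions k n +
    n * num_marked_partitions k (n - 1)"
proof -
  have interval: "{1..Suc k} = insert (Suc k) {1..k}"
    by auto
  have "num_marked_partitions (Suc k) n =
      (\<Sum>P | partition_on {1..k} P. fact n * (Suc (card P) choose n) + card P * (fact n * (card P choose n)))"
    unfolding num_marked_partitions_def interval by (rule sum_partition_on_insert) simp_all
  then show ?thesis
    unfolding fact_times_binomial_recurrence
    by (simp only: num_marked_partitions_def sum.distrib sum_distrib_left)
qed

lemma card_partition_on_le:
  assumes "finite S" "partition_on S P"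
  shows "card P \<le> card S"
proof -
  have fin: "finite B" "B \<noteq> {}" if "B \<in> P" for B
    using that assms finite_subset[of B S] by (auto simp: partition_on_def)
  have "card P = (\<Sum>B\<in>P. 1)"
    by simp
  also have "\<dots> \<le> (\<Sum>B\<in>P. card B)"
    using fin by (intro sum_mono) (simp add: Suc_le_eq card_gt_0_iff)
  also have "\<dots> = card S"
    using product_partition[OF assms(2)] fin by simp
  finally show ?thesis .
qed

lemma card_partly_ordered_set_partitions:
  "card (partly_ordered_set_partitions {1..k}) = (\<Sum>n\<le>k. num_marked_partitions k n)"
proof -
  let ?parts = "{P. partition_on {1..k} P}"
  let ?orders = "\<lambda>M :: nat set set. {r. linear_order_on M r}"
  have fin: "finite P" if "P \<in> ?parts" for P
    using that finite_elements[of "{1..k}"] by simp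
  have finM: "finite M" if "P \<in> ?parts" "M \<in> Pow P" for P M
    using fin[OF that(1)] that(2) finite_subset by auto
  have "partly_ordered_set_partitions {1..k} = (SIGMA P : ?parts. SIGMA M : Pow P. ?orders M)"
    by (auto simp: partly_ordered_set_partitions_def)
  then have "card (partly_ordered_set_partitions {1..k}) =
      (\<Sum>P\<in>?parts. card (SIGMA M : Pow P. ?orders M))"
    using fin finM
    by (simp only:) (intro card_SigmaI ballI finite_SigmaI finite_linear_orders
        finitely_many_partition_on, auto)
  also have "\<dots> = (\<Sum>P\<in>?parts. \<Sum>n\<le>k. fact n * (card P choose n))"
  proof (rule sum.cong[OF refl])
    fix P assume P: "P \<in> ?parts"
    have "card P \<le> k"
      using card_partition_on_le[of "{1..k}" P] P by simp
    have "card (SIGMA M : Pow P. ?orders M) = (\<Sum>M\<in>Pow P. card (?orders M))"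
      using fin[OF P] finM[OF P] by (intro card_SigmaI) (simp_all add: finite_linear_orders)
    also have "\<dots> = (\<Sum>M\<in>Pow P. fact (card M))"
      using finM[OF P] by (intro sum.cong refl card_linear_orders)
    also have "\<dots> = (\<Sum>n\<le>k. \<Sum>M | M \<in> Pow P \<and> card M = n. fact (card M))"
      using fin[OF P] \<open>card P \<le> k\<close>
      by (intro sum.group[symmetric]) (auto intro: card_mono order_trans)
    also have "\<dots> = (\<Sum>n\<le>k. fact n * (card P choose n))"
      using fin[OF P] by (intro sum.cong refl) (simp add: n_subsets)
    finally show "card (SIGMA M : Pow P. ?orders M) = (\<Sum>n\<le>k. fact n * (card P choose n))" .
  qed
  also have "\<dots> = (\<Sum>n\<le>k. num_marked_partitions k n)"
    unfolding num_marked_partitions_def by (rule sum.swap)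
  finally show ?thesis .
qed

section \<open>Comparison of the two counts\<close>

lemma tableau_weight_eq_num_marked_partitions: "tableau_weight k n = num_marked_partitions k n"
  by (induction k arbitrary: n)
    (simp_all only: tableau_weight_0 num_marked_partitions_0
      tableau_weight_Suc num_marked_partitions_Suc)

theorem theorem6:
  fixes k :: nat
  assumes "k \<ge> 1"
  shows "u k = card (partly_ordered_set_partitions {1..k})"
  by (simp only: u_eq_sum_tableau_weight card_partly_ordered_set_partitions
      tableau_weight_eq_num_marked_partitions)

end
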